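(* Let $H$ be a real symmetric matrix indexed by a finite set $V$ and let $a,b\in V$ be distinct. If $a,b$ are not strongly cospectral for $H$, then $\mathcal G(H;a,b)=\varnothing$. Otherwise, write $E_\lambda e_b=\sigma_\lambda E_\lambda e_a$ with $\sigma_\lambda\in\{1,-1\}$ for $\lambda$ in the common eigenvalue support of $a,b$, and consider the condition \[ (\ast)\qquad \sigma_\rho=\sigma_{-\rho}\quad\text{whenever both }\rho\text{ and }-\rho\text{ occur in the common eigenvalue support of }a,b. \] Then \[ \mathcal G(H;a,b)=\begin{cases}\mathbb N^+,&\text{if }(\ast)\text{ holds},\\ 2\mathbb N+1,&\text{otherwise.}\end{cases} \]
   Context: $\mathbb N=\{0,1,2,\ldots\}$ and $\mathbb N^+=\{1,2,3,\ldots\}$. $e_v$ denotes the standard basis vector indexed by $v\in V$. For a real symmetric matrix $H$ with spectral decomposition $H=\sum_{\lambda\in\operatorname{Spec}(H)}\lambda E_\lambda$ ($E_\lambda$ the orthogonal projection onto the $\lambda$-eigenspace), and a vector $x$, put $\operatorname{supp}_H(x)=\{\lambda\in\operatorname{Spec}(H):E_\lambda x\neq 0\}$. Vertices $a,b$ are strongly cospectral for $H$ if $\operatorname{supp}_H(e_a)=\operatorname{supp}_H(e_b)$ (the common eigenvalue support) and for each $\lambda$ in it $E_\lambda e_b=\sigma_\lambda E_\lambda e_a$ with some $\sigma_\lambda\in\{1,-1\}$. $\mathcal G(H;a,b)=\{k\in\mathbb N^+: a,b\text{ are strongly cospectral for }H^k\}$. *)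

theory Defs
  imports "HOL-Analysis.Analysis"
begin

(* The library's power operation on real^'v^'v is the entrywise one, so powers of matrices
   are iterated matrix products here. *)
primrec mat_pow :: "real^'v^'v \<Rightarrow> nat \<Rightarrow> real^'v^'v" where
  "mat_pow H 0 = mat 1"
| "mat_pow H (Suc k) = H ** mat_pow H k"

definition eigenspace :: "real^'v^'v \<Rightarrow> real \<Rightarrow> (real^'v) set" where
  "eigenspace H \<theta> = {x. H *v x = \<theta> *\<^sub>R x}"

definition Spec :: "(real^'v^'v) \<Rightarrow> real set" where
  "Spec H = {\<theta>. \<exists>x. x \<noteq> 0 \<and> H *v x = \<theta> *\<^sub>R x}"

(* Meaningful for a linear subspace S, where such a point exists uniquely;
   see orth_proj_exists_unique. *)
definition orth_proj :: "'a::euclidean_space set \<Rightarrow> 'a \<Rightarrow> 'a" where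
  "orth_proj S x = (THE y. y \<in> S \<and> (\<forall>s\<in>S. orthogonal (x - y) s))"

definition eig_proj :: "real^'v^'v \<Rightarrow> real \<Rightarrow> real^'v \<Rightarrow> real^'v" where
  "eig_proj H \<theta> = orth_proj (eigenspace H \<theta>)"

definition eig_supp :: "real^'v^'v \<Rightarrow> real^'v \<Rightarrow> real set" where
  "eig_supp H x = {\<theta> \<in> Spec H. eig_proj H \<theta> x \<noteq> 0}"

abbreviation basis_vec :: "'v \<Rightarrow> real^'v::finite" where
  "basis_vec v \<equiv> axis v 1"

definition strongly_cospectral :: "real^'v^'v \<Rightarrow> 'v \<Rightarrow> 'v \<Rightarrow> bool" where
  "strongly_cospectral H a b \<longleftrightarrow>
     eig_supp H (basis_vec a) = eig_supp H (basis_vec b) \<and>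
     (\<forall>\<theta> \<in> eig_supp H (basis_vec a). \<exists>\<sigma> \<in> {1, -1}.
        eig_proj H \<theta> (basis_vec b) = \<sigma> *\<^sub>R eig_proj H \<theta> (basis_vec a))"

definition sc_powers :: "real^'v^'v \<Rightarrow> 'v \<Rightarrow> 'v \<Rightarrow> nat set" where
  "sc_powers H a b = {k. k \<ge> 1 \<and> strongly_cospectral (mat_pow H k) a b}"

lemma subspace_eigenspace: "subspace (eigenspace H \<theta>)"
  unfolding subspace_def eigenspace_def
  by (auto simp: matrix_vector_right_distrib scaleR_right_distrib
      matrix_vector_mult_scaleR scaleR_left_commute mult.commute)

lemma orth_proj_exists_unique:
  fixes S :: "'a::euclidean_space set"
  assumes "subspace S"
  shows "\<exists>!y. y \<in> S \<and> (\<forall>s\<in>S. orthogonal (x - y) s)"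
proof -
  obtain y z where yz: "y \<in> span S" "\<And>w. w \<in> span S \<Longrightarrow> orthogonal z w" "x = y + z"
    using orthogonal_subspace_decomp_exists[of S x] by metis
  have S: "span S = S" using assms by (simp add: span_eq_iff)
  show ?thesis
  proof (rule ex1I[of _ y])
    show "y \<in> S \<and> (\<forall>s\<in>S. orthogonal (x - y) s)" using yz S by auto
  next
    fix u assume u: "u \<in> S \<and> (\<forall>s\<in>S. orthogonal (x - u) s)"
    have "y - u \<in> S" using u yz S assms by (simp add: subspace_diff)
    then have "(x - u) \<bullet> (y - u) = 0" "(x - y) \<bullet> (y - u) = 0"
      using u yz S by (auto simp: orthogonal_def)
    then have "(y - u) \<bullet> (y - u) = 0" by (simp add: inner_diff_left)
    then show "u = y" by simp
  qed
qed

end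

theory Submission
  imports Defs
begin

text \<open>
  Since H is symmetric, the kernel of \<open>H\<^sup>k - \<mu>I\<close> is the \<open>\<rho>\<close>-eigenspace of H when k is
  odd and \<open>\<mu> = \<rho>\<^sup>k\<close>, while for k even and \<open>\<mu> = \<rho>\<^sup>k\<close> with \<open>\<rho> > 0\<close> it is the orthogonal sum of the
  eigenspaces for \<open>\<rho>\<close> and \<open>-\<rho>\<close>. Hence odd powers leave the eigenprojections unchanged, and even powers
  merge those of \<open>\<plusminus>\<rho>\<close>, which forces the two signs to agree. The kernels are computed without the
  spectral theorem, using only that \<open>H\<^sup>2\<close> is positive semidefinite.
\<close>

section \<open>Powers of a symmetric matrix acting on vectors\<close>

lemma mat_pow_add: "mat_pow H (m + n) = mat_pow H m ** mat_pow H n"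
  by (induction m) (simp_all add: matrix_mul_assoc)

lemma mat_pow_add_mult_vec: "mat_pow H (m + n) *v x = mat_pow H m *v (mat_pow H n *v x)"
  by (simp add: mat_pow_add matrix_vector_mul_assoc)

lemma mat_pow_Suc_mult_vec: "mat_pow H (Suc n) *v x = H *v (mat_pow H n *v x)"
  by (simp add: matrix_vector_mul_assoc)

lemma symmetric_inner:
  fixes H :: "real^'v^'v"
  assumes "transpose H = H"
  shows "(H *v x) \<bullet> y = x \<bullet> (H *v y)"
  by (metis assms dot_lmul_matrix vector_transpose_matrix)

lemma symmetric_inner_mat_pow:
  fixes H :: "real^'v^'v"
  assumes "transpose H = H"
  shows "(mat_pow H n *v x) \<bullet> y = x \<bullet> (mat_pow H n *v y)"
proof (induction n arbitrary: y)
  case (Suc n)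
  have "(mat_pow H (Suc n) *v x) \<bullet> y = x \<bullet> (mat_pow H n *v (H *v y))"
    by (simp only: mat_pow_Suc_mult_vec symmetric_inner[OF assms] Suc)
  also have "mat_pow H n *v (H *v y) = mat_pow H (Suc n) *v y"
    using mat_pow_add_mult_vec[of H n 1 y] by simp
  finally show ?case .
qed simp

lemma mat_pow_eigenvector:
  assumes "H *v x = \<rho> *\<^sub>R x"
  shows "mat_pow H n *v x = \<rho> ^ n *\<^sub>R x"
  using assms by (induction n) (simp_all add: matrix_vector_mul_assoc[symmetric]
      matrix_vector_mult_scaleR mult.commute)

text \<open>Moving one factor across the inner product turns |H^(n+1) x|^2 into the product of H^n x
  with H^(n+2) x. So a vector killed by one power is killed by the previous one, down to H
  itself.\<close>

lemma symmetric_mat_pow_kernel: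
  fixes H :: "real^'v^'v"
  assumes "transpose H = H" and "mat_pow H (Suc n) *v x = 0"
  shows "H *v x = 0"
  using assms(2)
proof (induction n)
  case (Suc n)
  let ?y = "mat_pow H (Suc n) *v x"
  have "?y \<bullet> ?y = (mat_pow H n *v x) \<bullet> (mat_pow H (Suc (Suc n)) *v x)"
    using symmetric_inner[OF assms(1)] by (metis mat_pow_Suc_mult_vec)
  then have "?y = 0"
    using Suc.prems by (metis inner_eq_zero_iff inner_zero_right)
  then show ?case by (rule Suc.IH)
qed simp

text \<open>With y = (H^2 - \<rho>^2) x, the vector (H^(2m) - \<rho>^(2m)) x is the sum of
  \<rho>^(2(m-1-j)) H^(2j) y over j < m. Paired with y, every term is nonnegative, and the term j =
  0 is \<rho>^(2(m-1)) |y|^2. If the sum vanishes and \<rho> \<noteq> 0, then y = 0.\<close>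

lemma symmetric_even_power_eigenvector:
  fixes H :: "real^'v^'v"
  assumes sym: "transpose H = H" and "m > 0"
    and eq: "mat_pow H (2 * m) *v x = \<rho> ^ (2 * m) *\<^sub>R x"
  shows "H *v (H *v x) = \<rho>\<^sup>2 *\<^sub>R x"
proof (cases "\<rho> = 0")
  case True
  \<comment> \<open>At \<rho> = 0 the factor \<rho>^(2(m-1)) can vanish, so the kernel argument
    replaces the estimate.\<close>
  then have "mat_pow H (Suc (2 * m - 1)) *v x = 0"
    using eq \<open>m > 0\<close> by (simp add: power_0_left del: mat_pow.simps)
  then show ?thesis
    using symmetric_mat_pow_kernel[OF sym] True by simp
next
  case False
  define y where "y = H *v (H *v x) - \<rho>\<^sup>2 *\<^sub>R x"
  \<comment> \<open>\<open>c\<close> gives the partial sums recursively: \<open>c (Suc k)\<close> is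
    \<rho>^2 \<open>c k\<close> plus the square |H^k y|^2.\<close>
  define c where "c k = y \<bullet> (mat_pow H (2 * k) *v x - \<rho> ^ (2 * k) *\<^sub>R x)" for k
  have step: "c (Suc k) \<ge> \<rho>\<^sup>2 * c k" for k
  proof -
    have "mat_pow H (2 * Suc k) *v x = mat_pow H (2 * k) *v (H *v (H *v x))"
      using mat_pow_add_mult_vec[of H "2 * k" 2 x]
      by (simp add: numeral_2_eq_2 matrix_vector_mul_assoc)
    also have "H *v (H *v x) = y + \<rho>\<^sup>2 *\<^sub>R x"
      by (simp add: y_def)
    finally have "c (Suc k) = y \<bullet> (mat_pow H (2 * k) *v y) + \<rho>\<^sup>2 * c k"
      by (simp add: c_def matrix_vector_right_distrib matrix_vector_mult_scaleR
          inner_add_right inner_diff_right algebra_simps power2_eq_square)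
    moreover have "y \<bullet> (mat_pow H (2 * k) *v y) = (mat_pow H k *v y) \<bullet> (mat_pow H k *v y)"
      by (simp add: mult_2 mat_pow_add_mult_vec symmetric_inner_mat_pow[OF sym])
    ultimately show ?thesis by simp
  qed
  have "c (Suc k) \<ge> \<rho> ^ (2 * k) * (y \<bullet> y)" for k
  proof (induction k)
    case 0
    show ?case
      by (simp add: c_def y_def numeral_2_eq_2 matrix_vector_mul_assoc)
  next
    case (Suc k)
    have "\<rho> ^ (2 * Suc k) * (y \<bullet> y) = \<rho>\<^sup>2 * (\<rho> ^ (2 * k) * (y \<bullet> y))"
      by (simp add: power2_eq_square)
    also have "\<dots> \<le> \<rho>\<^sup>2 * c (Suc k)"
      using Suc by (intro mult_left_mono) auto
    finally show ?case using step[of "Suc k"] by linarith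
  qed
  \<comment> \<open>The index m - 1 bounds \<open>c m\<close>, which is 0 by
    \<open>eq\<close>.\<close>
  from this[of "m - 1"] have "\<rho> ^ (2 * (m - 1)) * (y \<bullet> y) \<le> 0"
    using \<open>m > 0\<close> eq by (simp add: c_def)
  moreover have "\<rho> ^ (2 * (m - 1)) > 0"
    using False by (simp add: power_mult)
  ultimately have "y \<bullet> y \<le> 0"
    by (simp add: mult_le_0_iff)
  then have "y = 0" by (metis inner_gt_zero_iff not_le)
  then show ?thesis by (simp add: y_def)
qed

section \<open>Eigenspaces of odd and even powers\<close>

lemma mat_pow_even_eigenvector:
  assumes "H *v (H *v x) = \<rho>\<^sup>2 *\<^sub>R x"
  shows "mat_pow H (2 * n) *v x = \<rho> ^ (2 * n) *\<^sub>R x"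
proof (induction n)
  case (Suc n)
  have "mat_pow H (2 * Suc n) *v x = H *v (H *v (mat_pow H (2 * n) *v x))"
    by (simp add: matrix_vector_mul_assoc)
  also have "\<dots> = \<rho> ^ (2 * n) *\<^sub>R (H *v (H *v x))"
    by (simp only: Suc matrix_vector_mult_scaleR)
  also have "\<dots> = \<rho> ^ (2 * Suc n) *\<^sub>R x"
    by (simp only: assms scaleR_scaleR flip: power_add) simp
  finally show ?case .
qed simp

text \<open>Applying H^k twice gives an even power, hence H^2 x = \<rho>^2 x. This evaluates all but
  one factor of H^k x, and cancelling \<rho>^(k-1) leaves H x = \<rho> x.\<close>

lemma eigenspace_odd_power:
  fixes H :: "real^'v^'v"
  assumes sym: "transpose H = H" and "odd k"
  shows "eigenspace (mat_pow H k) (\<rho> ^ k) = eigenspace H \<rho>"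
proof
  show "eigenspace H \<rho> \<subseteq> eigenspace (mat_pow H k) (\<rho> ^ k)"
    by (auto simp: eigenspace_def mat_pow_eigenvector)
  show "eigenspace (mat_pow H k) (\<rho> ^ k) \<subseteq> eigenspace H \<rho>"
  proof
    fix x assume "x \<in> eigenspace (mat_pow H k) (\<rho> ^ k)"
    then have x: "mat_pow H k *v x = \<rho> ^ k *\<^sub>R x" by (simp add: eigenspace_def)
    obtain m where k: "k = Suc (2 * m)" using \<open>odd k\<close> by (auto elim: oddE)
    have "mat_pow H (2 * k) *v x = \<rho> ^ (2 * k) *\<^sub>R x"
      by (simp add: mult_2 mat_pow_add_mult_vec x matrix_vector_mult_scaleR power_add)
    then have 2: "H *v (H *v x) = \<rho>\<^sup>2 *\<^sub>R x"
      using symmetric_even_power_eigenvector[OF sym, of k] k by simp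
    have *: "\<rho> ^ (2 * m) *\<^sub>R (H *v x) = \<rho> ^ (2 * m) *\<^sub>R (\<rho> *\<^sub>R x)"
      using x mat_pow_even_eigenvector[OF 2, of m] unfolding k mat_pow_Suc_mult_vec
      by (simp add: matrix_vector_mult_scaleR mult.commute)
    show "x \<in> eigenspace H \<rho>"
    proof (cases "\<rho> = 0")
      case True
      then show ?thesis using x symmetric_mat_pow_kernel[OF sym, of "2 * m" x] unfolding k
        by (simp add: eigenspace_def)
    next
      case False
      with * have "H *v x = \<rho> *\<^sub>R x" by (metis power_not_zero scaleR_cancel_left)
      then show ?thesis by (simp add: eigenspace_def)
    qed
  qed
qed

text \<open>Describing the space by H^2 covers \<rho> = 0 as well; the splitting into the parts for
  \<rho> and -\<rho> is available only for \<rho> \<noteq> 0.\<close>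

lemma eigenspace_even_power:
  fixes H :: "real^'v^'v"
  assumes sym: "transpose H = H" and "even k" "k > 0"
  shows "eigenspace (mat_pow H k) (\<rho> ^ k) = {x. H *v (H *v x) = \<rho>\<^sup>2 *\<^sub>R x}"
proof -
  obtain m where k: "k = 2 * m" using \<open>even k\<close> by (auto elim: evenE)
  show ?thesis
  proof (intro set_eqI iffI)
    fix x assume "x \<in> eigenspace (mat_pow H k) (\<rho> ^ k)"
    then show "x \<in> {x. H *v (H *v x) = \<rho>\<^sup>2 *\<^sub>R x}"
      using symmetric_even_power_eigenvector[OF sym, of m x \<rho>] \<open>k > 0\<close>
      by (simp add: eigenspace_def k)
  next
    fix x assume "x \<in> {x. H *v (H *v x) = \<rho>\<^sup>2 *\<^sub>R x}"
    then have "H *v (H *v x) = \<rho>\<^sup>2 *\<^sub>R x" by simp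
    from mat_pow_even_eigenvector[OF this, of m] show "x \<in> eigenspace (mat_pow H k) (\<rho> ^ k)"
      by (simp add: eigenspace_def k)
  qed
qed

text \<open>An even power is positive semidefinite, being the square of a symmetric matrix.\<close>

lemma eigenspace_even_power_neg:
  fixes H :: "real^'v^'v"
  assumes sym: "transpose H = H" and "even k" and "\<mu> < 0"
  shows "eigenspace (mat_pow H k) \<mu> = {0}"
proof -
  obtain m where k: "k = m + m" using \<open>even k\<close> by (auto elim: evenE simp: mult_2)
  have "x = 0" if "mat_pow H k *v x = \<mu> *\<^sub>R x" for x
  proof -
    have "(mat_pow H m *v x) \<bullet> (mat_pow H m *v x) = x \<bullet> (mat_pow H k *v x)"
      by (simp add: k mat_pow_add_mult_vec symmetric_inner_mat_pow[OF sym])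
    also have "\<dots> = \<mu> * (x \<bullet> x)" using that by simp
    finally have "\<mu> * (x \<bullet> x) \<ge> 0" by (metis inner_ge_zero)
    then have "x \<bullet> x \<le> 0" using \<open>\<mu> < 0\<close> by (simp add: zero_le_mult_iff)
    then show ?thesis by (metis inner_gt_zero_iff not_le)
  qed
  then show ?thesis by (auto simp: eigenspace_def)
qed

section \<open>Eigenprojections of odd and even powers\<close>

lemma orth_proj_eqI:
  fixes S :: "'a::euclidean_space set"
  assumes "subspace S" "y \<in> S" "\<And>s. s \<in> S \<Longrightarrow> orthogonal (x - y) s"
  shows "orth_proj S x = y"
  unfolding orth_proj_def
  by (rule the1_equality[OF orth_proj_exists_unique]) (use assms in auto)

lemma
  fixes S :: "'a::euclidean_space set"
  assumes "subspace S"
  shows orth_proj_mem: "orth_proj S x \<in> S"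
    and orth_proj_orthogonal: "s \<in> S \<Longrightarrow> orthogonal (x - orth_proj S x) s"
  using theI'[OF orth_proj_exists_unique[OF assms, of x]]
  unfolding orth_proj_def by auto

lemma eig_proj_mem: "eig_proj H \<theta> x \<in> eigenspace H \<theta>"
  unfolding eig_proj_def by (rule orth_proj_mem[OF subspace_eigenspace])

lemma eig_proj_orthogonal: "s \<in> eigenspace H \<theta> \<Longrightarrow> orthogonal (x - eig_proj H \<theta> x) s"
  unfolding eig_proj_def by (rule orth_proj_orthogonal[OF subspace_eigenspace])

lemma eig_proj_odd_power:
  fixes H :: "real^'v^'v"
  assumes "transpose H = H" and "odd k"
  shows "eig_proj (mat_pow H k) (\<rho> ^ k) = eig_proj H \<rho>"
  by (simp add: eig_proj_def eigenspace_odd_power[OF assms])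

text \<open>At \<rho> = 0 the two eigenspaces for \<rho> and -\<rho> coincide, and adding their
  projections would count the same one twice.\<close>

lemma eig_proj_even_power_zero:
  fixes H :: "real^'v^'v"
  assumes "transpose H = H" and "even k" "k > 0"
  shows "eig_proj (mat_pow H k) 0 = eig_proj H 0"
proof -
  have "H *v (H *v x) = 0 \<longleftrightarrow> H *v x = 0" for x
    using symmetric_mat_pow_kernel[OF assms(1), of 1 x]
    by (auto simp: matrix_vector_mul_assoc[symmetric])
  then have "eigenspace (mat_pow H k) 0 = eigenspace H 0"
    using eigenspace_even_power[OF assms, of 0] \<open>k > 0\<close>
    by (auto simp: eigenspace_def power_0_left)
  then show ?thesis by (simp add: eig_proj_def)
qed

lemma eig_proj_even_power_neg:
  fixes H :: "real^'v^'v"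
  assumes "transpose H = H" and "even k" and "\<mu> < 0"
  shows "eig_proj (mat_pow H k) \<mu> x = 0"
  using eig_proj_mem[of "mat_pow H k" \<mu> x] by (simp add: eigenspace_even_power_neg[OF assms])

lemma eigenspace_orthogonal:
  fixes H :: "real^'v^'v"
  assumes "transpose H = H" and "u \<in> eigenspace H \<theta>" "v \<in> eigenspace H \<phi>" "\<theta> \<noteq> \<phi>"
  shows "u \<bullet> v = 0"
proof -
  have "\<theta> * (u \<bullet> v) = \<phi> * (u \<bullet> v)"
    using symmetric_inner[OF assms(1), of u v] assms(2,3) by (simp add: eigenspace_def)
  then show ?thesis using assms(4) by simp
qed

lemma eig_proj_even_power:
  fixes H :: "real^'v^'v"
  assumes sym: "transpose H = H" and k: "even k" "k > 0" and "\<rho> \<noteq> 0"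
  shows "eig_proj (mat_pow H k) (\<rho> ^ k) x = eig_proj H \<rho> x + eig_proj H (- \<rho>) x"
proof -
  let ?S = "eigenspace (mat_pow H k) (\<rho> ^ k)"
  note S = eigenspace_even_power[OF sym k, of \<rho>]
  have sub: "eigenspace H \<rho> \<subseteq> ?S" "eigenspace H (- \<rho>) \<subseteq> ?S"
    using mat_pow_eigenvector[where ?H = H and n = k and ?\<rho> = \<rho>]
      mat_pow_eigenvector[where ?H = H and n = k and ?\<rho> = "- \<rho>"] \<open>even k\<close>
    by (auto simp: eigenspace_def)
  have ne: "\<rho> \<noteq> - \<rho>" "- \<rho> \<noteq> \<rho>" using \<open>\<rho> \<noteq> 0\<close> by auto
  have orth: "orthogonal (x - (eig_proj H \<rho> x + eig_proj H (- \<rho>) x)) s" if "s \<in> ?S" for s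
  proof -
    \<comment> \<open>On \<open>?S\<close> the product (H - \<rho>)(H + \<rho>) is zero, so (1 +
      H/\<rho>)/2 and (1 - H/\<rho>)/2 give the components of \<open>s\<close> for \<rho> and
      -\<rho>.\<close>
    define u where "u = (1/2) *\<^sub>R (s + (1/\<rho>) *\<^sub>R (H *v s))"
    define v where "v = (1/2) *\<^sub>R (s - (1/\<rho>) *\<^sub>R (H *v s))"
    have Hs: "H *v (H *v s) = \<rho>\<^sup>2 *\<^sub>R s" using that unfolding S by simp
    have u: "u \<in> eigenspace H \<rho>" and v: "v \<in> eigenspace H (- \<rho>)"
      using \<open>\<rho> \<noteq> 0\<close> unfolding u_def v_def eigenspace_def
      by (auto simp: Hs matrix_vector_right_distrib matrix_vector_mult_diff_distrib
          matrix_vector_mult_scaleR power2_eq_square algebra_simps)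
    have "s = u + v"
      unfolding u_def v_def by (simp add: scaleR_add_right scaleR_diff_right
          scaleR_add_left[symmetric])
    moreover have "(x - eig_proj H \<rho> x) \<bullet> u = 0" "(x - eig_proj H (- \<rho>) x) \<bullet> v = 0"
      using eig_proj_orthogonal[OF u] eig_proj_orthogonal[OF v] by (auto simp: orthogonal_def)
    moreover have "eig_proj H (- \<rho>) x \<bullet> u = 0" "eig_proj H \<rho> x \<bullet> v = 0"
      using eigenspace_orthogonal[OF sym eig_proj_mem u ne(2)]
        eigenspace_orthogonal[OF sym eig_proj_mem v ne(1)] by auto
    ultimately show ?thesis
      by (simp add: orthogonal_def inner_diff_left inner_add_left inner_add_right)
  qed
  show ?thesis
    unfolding eig_proj_def[of "mat_pow H k"]
    by (rule orth_proj_eqI[OF subspace_eigenspace _ orth])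
      (use sub eig_proj_mem subspace_add[OF subspace_eigenspace] in blast)+
qed

text \<open>H turns the sum into \<rho> times the difference, and sum and difference determine both
  components. Thus an equation between merged projections can be read off separately at \<rho> and
  -\<rho>.\<close>

lemma eigenspace_add_minus_eq_iff:
  fixes H :: "real^'v^'v"
  assumes "u \<in> eigenspace H \<rho>" "u' \<in> eigenspace H \<rho>"
    and "v \<in> eigenspace H (- \<rho>)" "v' \<in> eigenspace H (- \<rho>)" and "\<rho> \<noteq> 0"
  shows "u + v = u' + v' \<longleftrightarrow> u = u' \<and> v = v'"
proof
  assume eq: "u + v = u' + v'"
  then have "H *v (u + v) = H *v (u' + v')" by simp
  then have "\<rho> *\<^sub>R (u - v) = \<rho> *\<^sub>R (u' - v')"
    using assms by (simp add: eigenspace_def matrix_vector_right_distrib scaleR_diff_right)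
  then have diff: "u - v = u' - v'" using \<open>\<rho> \<noteq> 0\<close> by simp
  have "(u + v) + (u - v) = (u' + v') + (u' - v')" using eq diff by simp
  then have "2 *\<^sub>R u = 2 *\<^sub>R u'" by (simp add: scaleR_2)
  then have "u = u'" by simp
  with eq show "u = u' \<and> v = v'" by simp
qed simp

section \<open>Strong cospectrality of powers\<close>

lemma eig_supp_iff: "\<theta> \<in> eig_supp H x \<longleftrightarrow> eig_proj H \<theta> x \<noteq> 0"
  \<comment> \<open>A nonzero projection is itself an eigenvector, so membership in
    \<open>Spec H\<close> is automatic.\<close>
  using eig_proj_mem[of H \<theta> x] by (auto simp: eig_supp_def Spec_def eigenspace_def)

text \<open>Off the support both projections vanish and either sign works; conversely, a nonzero
  sign forces equal supports. Quantifying over all reals avoids computing the spectrum of a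
  power.\<close>

lemma strongly_cospectral_iff:
  "strongly_cospectral H a b \<longleftrightarrow>
    (\<forall>\<theta>. \<exists>\<sigma>\<in>{1, -1}. eig_proj H \<theta> (basis_vec b) = \<sigma> *\<^sub>R eig_proj H \<theta> (basis_vec a))"
  (is "_ \<longleftrightarrow> (\<forall>\<theta>. ?P \<theta>)")
proof
  assume L: "strongly_cospectral H a b"
  show "\<forall>\<theta>. ?P \<theta>"
  proof
    fix \<theta>
    show "?P \<theta>"
    proof (cases "\<theta> \<in> eig_supp H (basis_vec a)")
      case False
      then have "\<theta> \<notin> eig_supp H (basis_vec b)"
        using L by (simp add: strongly_cospectral_def)
      with False show ?thesis by (auto simp: eig_supp_iff)
    qed (use L in \<open>auto simp: strongly_cospectral_def\<close>)
  qed
next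
  assume R: "\<forall>\<theta>. ?P \<theta>"
  have "\<theta> \<in> eig_supp H (basis_vec a) \<longleftrightarrow> \<theta> \<in> eig_supp H (basis_vec b)" for \<theta>
    using spec[OF R, of \<theta>] by (auto simp: eig_supp_iff)
  then have "eig_supp H (basis_vec a) = eig_supp H (basis_vec b)"
    by blast
  with R show "strongly_cospectral H a b" by (simp add: strongly_cospectral_def)
qed

lemma strongly_cospectral_odd_power:
  fixes H :: "real^'v^'v"
  assumes "transpose H = H" and "odd k"
  shows "strongly_cospectral (mat_pow H k) a b \<longleftrightarrow> strongly_cospectral H a b"
proof -
  \<comment> \<open>Odd roots exist for every real, so the eigenprojections at the numbers \<rho>^k
    are all of them.\<close>
  have "\<exists>\<rho>. \<mu> = \<rho> ^ k" for \<mu> :: real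
    using odd_real_root_pow[OF \<open>odd k\<close>, of \<mu>] by metis
  then show ?thesis
    unfolding strongly_cospectral_iff by (metis eig_proj_odd_power[OF assms])
qed

text \<open>The eigenvalue \<rho>^k carries the sum of the projections for \<rho> and -\<rho>, and a
  sign on that sum must act on both summands.\<close>

lemma strongly_cospectral_even_power:
  fixes H :: "real^'v^'v"
  assumes sym: "transpose H = H" and k: "even k" "k > 0"
  shows "strongly_cospectral (mat_pow H k) a b \<longleftrightarrow>
    (\<forall>\<rho>. \<exists>\<sigma>\<in>{1, -1}. \<forall>\<theta>\<in>{\<rho>, - \<rho>}.
       eig_proj H \<theta> (basis_vec b) = \<sigma> *\<^sub>R eig_proj H \<theta> (basis_vec a))"
  (is "_ \<longleftrightarrow> (\<forall>\<rho>. \<exists>\<sigma>\<in>_. ?Q \<rho> \<sigma>)")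
proof -
  have Q: "eig_proj (mat_pow H k) (\<rho> ^ k) (basis_vec b) =
      \<sigma> *\<^sub>R eig_proj (mat_pow H k) (\<rho> ^ k) (basis_vec a) \<longleftrightarrow> ?Q \<rho> \<sigma>" for \<rho> \<sigma>
  proof (cases "\<rho> = 0")
    case True
    \<comment> \<open>Here {\<rho>, -\<rho>} is a single point, and \<open>k > 0\<close> makes
      \<rho>^k equal to 0.\<close>
    then show ?thesis using eig_proj_even_power_zero[OF assms] k by (simp add: power_0_left)
  next
    case False
    have "\<sigma> *\<^sub>R eig_proj H \<theta> x \<in> eigenspace H \<theta>" for \<theta> x
      by (rule subspace_scale[OF subspace_eigenspace eig_proj_mem])
    from eigenspace_add_minus_eq_iff[OF eig_proj_mem this eig_proj_mem this False]
    show ?thesis by (simp add: eig_proj_even_power[OF assms False] scaleR_add_right)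
  qed
  \<comment> \<open>Numbers that are not k-th powers are negative, and there both projections are
    0.\<close>
  have "\<mu> < 0 \<or> (\<exists>\<rho>. \<mu> = \<rho> ^ k)" for \<mu> :: real
    using real_root_pow_pos2[OF \<open>k > 0\<close>, of \<mu>] by (metis not_le)
  then show ?thesis
    unfolding strongly_cospectral_iff Q[symmetric]
    using eig_proj_even_power_neg[OF sym \<open>even k\<close>]
    by (metis insertI1 scaleR_zero_right)
qed

theorem theorem2p4:
  fixes H :: "real^'v^'v" and a b :: 'v
  assumes "transpose H = H" and "a \<noteq> b"
  shows "(\<not> strongly_cospectral H a b \<longrightarrow> sc_powers H a b = {}) \<and>
    (strongly_cospectral H a b \<longrightarrow>
      (\<forall>\<sigma> :: real \<Rightarrow> real.
        (\<forall>\<theta> \<in> eig_supp H (basis_vec a).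
           \<sigma> \<theta> \<in> {1, -1} \<and>
           eig_proj H \<theta> (basis_vec b) = \<sigma> \<theta> *\<^sub>R eig_proj H \<theta> (basis_vec a)) \<longrightarrow>
        sc_powers H a b =
          (if \<forall>\<rho>. \<rho> \<in> eig_supp H (basis_vec a) \<and> - \<rho> \<in> eig_supp H (basis_vec a)
                 \<longrightarrow> \<sigma> \<rho> = \<sigma> (- \<rho>)
           then {1..} else {2 * n + 1 | n. True})))"
proof (intro conjI impI allI)
  assume N: "\<not> strongly_cospectral H a b"
  have "\<not> strongly_cospectral (mat_pow H k) a b" if "k \<ge> 1" for k
  proof (cases "odd k")
    case True
    with N show ?thesis by (simp add: strongly_cospectral_odd_power[OF assms(1)])
  next
    case False
    then have k: "even k" "k > 0" using that by auto
    \<comment> \<open>The even-power criterion restricted to \<theta> = \<rho> is already strong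
      cospectrality for H.\<close>
    from N show ?thesis
      unfolding strongly_cospectral_even_power[OF assms(1) k]
      unfolding strongly_cospectral_iff by blast
  qed
  then show "sc_powers H a b = {}" by (auto simp: sc_powers_def)
next
  fix \<sigma> :: "real \<Rightarrow> real"
  let ?S = "eig_supp H (basis_vec a)"
  let ?cond = "\<forall>\<rho>. \<rho> \<in> ?S \<and> - \<rho> \<in> ?S \<longrightarrow> \<sigma> \<rho> = \<sigma> (- \<rho>)"
  assume sc: "strongly_cospectral H a b"
    and \<sigma>: "\<forall>\<theta>\<in>?S. \<sigma> \<theta> \<in> {1, -1} \<and>
      eig_proj H \<theta> (basis_vec b) = \<sigma> \<theta> *\<^sub>R eig_proj H \<theta> (basis_vec a)"
  have outside: "eig_proj H \<theta> (basis_vec a) = 0" "eig_proj H \<theta> (basis_vec b) = 0"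
    if "\<theta> \<notin> ?S" for \<theta>
    using that sc by (auto simp: strongly_cospectral_def eig_supp_iff)
  \<comment> \<open>On the support the projection of the first basis vector is nonzero, so the
    scalar is determined; elsewhere the equation reads 0 = 0.\<close>
  have same: "eig_proj H \<theta> (basis_vec b) = s *\<^sub>R eig_proj H \<theta> (basis_vec a) \<longleftrightarrow>
      (\<theta> \<in> ?S \<longrightarrow> s = \<sigma> \<theta>)" for \<theta> s
  proof (cases "\<theta> \<in> ?S")
    case True
    then show ?thesis using bspec[OF \<sigma> True] by (auto simp: eig_supp_iff)
  qed (simp add: outside)
  \<comment> \<open>A common sign is constrained only at those of \<rho>, -\<rho> that lie in the
    support, so a conflict needs both.\<close>
  have merge: "(\<exists>s\<in>{1, -1}. \<forall>\<theta>\<in>{\<rho>, - \<rho>}. \<theta> \<in> ?S \<longrightarrow> s = \<sigma> \<theta>) \<longleftrightarrow>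
      (\<rho> \<in> ?S \<and> - \<rho> \<in> ?S \<longrightarrow> \<sigma> \<rho> = \<sigma> (- \<rho>))" for \<rho>
  proof -
    have "(\<exists>s\<in>{1, -1}. (A \<longrightarrow> s = x) \<and> (B \<longrightarrow> s = y)) \<longleftrightarrow> (A \<and> B \<longrightarrow> x = y)"
      if "A \<Longrightarrow> x \<in> {1, -1}" "B \<Longrightarrow> y \<in> {1, -1}" for A B and x y :: real
      using that by (cases A; cases B) auto
    from this[of "\<rho> \<in> ?S" "\<sigma> \<rho>" "- \<rho> \<in> ?S" "\<sigma> (- \<rho>)"] \<sigma>
    show ?thesis by simp
  qed
  define c where "c \<longleftrightarrow> ?cond"
  have even: "strongly_cospectral (mat_pow H k) a b \<longleftrightarrow> c" if "even k" "k > 0" for k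
    unfolding strongly_cospectral_even_power[OF assms(1) that] same merge c_def ..
  have iff: "k \<in> sc_powers H a b \<longleftrightarrow> k \<ge> 1 \<and> (odd k \<or> c)" for k
  proof (cases "odd k")
    case True
    then show ?thesis
      using strongly_cospectral_odd_power[OF assms(1) True, of a b] sc by (simp add: sc_powers_def)
  next
    case False
    then show ?thesis using even[of k] by (auto simp: sc_powers_def)
  qed
  have "sc_powers H a b = (if c then {1..} else {2 * n + 1 | n. True})"
  proof (cases c)
    case True
    then show ?thesis by (auto simp: iff)
  next
    case False
    have "k \<ge> 1 \<and> odd k \<longleftrightarrow> (\<exists>n. k = 2 * n + 1)" for k :: nat
      by (auto elim: oddE)
    with False show ?thesis by (auto simp: iff)
  qed
  then show "sc_powers H a b = (if ?cond then {1..} else {2 * n + 1 | n. True})"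
    unfolding c_def .
qed

end
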